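(* Let $n\ge1$ and let $A,B\subset\mathbb{R}^n$ be closed convex sets which are symmetric about the origin. Then $$\mu_n(A)\,\mu_n(B)\ \le\ 2^{n/2}\,\mu_n(A\cap B).$$
   Context: $\mu_n$ denotes the standard Gaussian measure on $\mathbb{R}^n$, $\mu_n(A)=(2\pi)^{-n/2}\int_A e^{-|x|^2/2}\,dx$. A set $A$ is symmetric about the origin if $A=-A$. *)

theory Defs
  imports "HOL-Probability.Probability"
begin

definition gaussian_measure :: "'a::euclidean_space measure" where
  "gaussian_measure =
     density lborel (\<lambda>x. ennreal ((2 * pi) powr (- (real DIM('a) / 2)) * exp (- (norm x)\<^sup>2 / 2)))"

lemma sets_gaussian_measure [measurable_cong, simp]: "sets gaussian_measure = sets borel"
  by (simp add: gaussian_measure_def)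

lemma space_gaussian_measure [simp]: "space gaussian_measure = UNIV"
  by (simp add: gaussian_measure_def)

lemma gaussian_density_prod:
  fixes x :: "'a::euclidean_space"
  shows "(2 * pi) powr (- (real DIM('a) / 2)) * exp (- (norm x)\<^sup>2 / 2)
       = (\<Prod>b\<in>Basis. std_normal_density (x \<bullet> b))"
proof -
  have "1 / sqrt (2 * pi) = (2 * pi) powr (- (1/2))"
    by (simp add: powr_minus_divide powr_half_sqrt)
  then have "(1 / sqrt (2 * pi)) ^ DIM('a) = (2 * pi) powr (- (real DIM('a) / 2))"
    by (simp add: powr_powr flip: powr_realpow)
  moreover have "(norm x)\<^sup>2 = (\<Sum>b\<in>Basis. (x \<bullet> b)\<^sup>2)"
    unfolding power2_norm_eq_inner by (subst euclidean_inner) (simp add: power2_eq_square)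
  then have "exp (- (norm x)\<^sup>2 / 2) = (\<Prod>b\<in>Basis. exp (- (x \<bullet> b)\<^sup>2 / 2))"
    by (simp add: exp_sum[symmetric] sum_negf sum_divide_distrib)
  ultimately show ?thesis
    unfolding std_normal_density_def by (simp only: prod.distrib prod_constant)
qed

lemma prob_space_gaussian_measure: "prob_space (gaussian_measure :: 'a::euclidean_space measure)"
proof
  have "emeasure (gaussian_measure :: 'a measure) UNIV
      = (\<integral>\<^sup>+x. (\<Prod>b\<in>Basis. ennreal (std_normal_density ((x::'a) \<bullet> b))) \<partial>lborel)"
    unfolding gaussian_measure_def gaussian_density_prod
    by (subst emeasure_density) (simp_all add: prod_ennreal)
  also have "\<dots> = (\<Prod>b\<in>(Basis :: 'a set). (\<integral>\<^sup>+x. ennreal (std_normal_density x) \<partial>lborel))"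
    by (intro nn_integral_lborel_prod) auto
  also have "(\<integral>\<^sup>+x. ennreal (std_normal_density x) \<partial>lborel) = 1"
    using prob_space.emeasure_space_1[OF prob_space_normal_density[of 1 0]]
    by (simp add: emeasure_density)
  finally show "emeasure (gaussian_measure :: 'a measure) (space gaussian_measure) = 1"
    by simp
qed

definition symmetric_about_origin :: "'a::real_vector set \<Rightarrow> bool" where
  "symmetric_about_origin A \<longleftrightarrow> A = uminus ` A"

end

theory Submission
  imports Defs
begin

text \<open>Substituting \<open>x = u + v\<close>, \<open>y = u - v\<close> in the double integral for the left-hand side gives, up to
  normalisation, the integral over \<open>v\<close> of \<open>exp (-|v|^2)\<close> times the mass of \<open>(A - v) \<inter> (B + v)\<close> under the
  density \<open>exp (-|u|^2)\<close>.  By symmetry and convexity the midpoints of \<open>(A - v) \<inter> (B + v)\<close> and its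
  reflection lie in \<open>A \<inter> B\<close>, so by the Prekopa--Leindler inequality that mass is largest for \<open>v = 0\<close>.
  It remains to bound \<open>exp (-|u|^2)\<close> by \<open>exp (-|u|^2 / 2)\<close> on \<open>A \<inter> B\<close>.\<close>

section \<open>The Prekopa--Leindler inequality\<close>

text \<open>Inner regularity: up to \<open>e\<close> the set is exhausted by a closed
  \<open>T\<close>, and \<open>T\<close> by its compact intersections with balls. This reduces
  one-dimensional Brunn--Minkowski to compact sets.\<close>

lemma emeasure_le_if_compact_le:
  fixes A :: "'a::euclidean_space set" and c :: ennreal
  assumes A [measurable]: "A \<in> sets borel"
    and le: "\<And>K. compact K \<Longrightarrow> K \<subseteq> A \<Longrightarrow> emeasure lborel K \<le> c"
  shows "emeasure lborel A \<le> c"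
proof (rule ennreal_le_epsilon)
  fix e :: real assume "0 < e"
  obtain T where T: "closed T" "T \<subseteq> A" "emeasure lebesgue (A - T) < ennreal e"
  proof (rule sets_lebesgue_inner_closed[OF _ \<open>0 < e\<close>])
    show "A \<in> sets lebesgue"
      using A by simp
  qed
  have [measurable]: "T \<in> sets borel"
    using T by auto
  have "emeasure lborel T = emeasure lborel (\<Union>n::nat. T \<inter> cball 0 (real n))"
    by (intro arg_cong[where f = "emeasure lborel"]) (use real_arch_simple in auto)
  also have "\<dots> = (SUP n. emeasure lborel (T \<inter> cball 0 (real n)))"
    by (intro SUP_emeasure_incseq[symmetric]) (auto simp: incseq_def)
  also have "\<dots> \<le> c"
    using T by (intro SUP_least le closed_Int_compact) auto
  finally have "emeasure lborel T \<le> c" .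
  moreover have "emeasure lborel A \<le> emeasure lborel T + emeasure lborel (A - T)"
    using emeasure_subadditive[of T lborel "A - T"] T by (simp add: Un_absorb1)
  ultimately show "emeasure lborel A \<le> c + ennreal e"
    using T(3) by (auto intro: order_trans[OF _ add_mono])
qed

lemma emeasure_lborel_vimage_double:
  fixes A :: "real set"
  assumes [measurable]: "A \<in> sets borel"
  shows "emeasure lborel A = 2 * emeasure lborel {z. 2 * z - b \<in> A}"
proof -
  have "emeasure lborel A = (\<integral>\<^sup>+x. indicator A x \<partial>lborel)"
    by simp
  also have "\<dots> = 2 * (\<integral>\<^sup>+z. indicator A (- b + 2 * z) \<partial>lborel)"
    by (subst nn_integral_real_affine[where c = 2 and t = "- b"]) auto
  also have "(\<lambda>z. indicator A (- b + 2 * z) :: ennreal) = indicator {z. 2 * z - b \<in> A}"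
    by (auto simp: indicator_def fun_eq_iff)
  finally show ?thesis
    by simp
qed

text \<open>Compactness supplies a largest point of \<open>K\<close> and a smallest point of
  \<open>L\<close>. Pairing each with the other set gives half-size copies of \<open>L\<close> and
  \<open>K\<close> made of midpoints, lying on opposite sides of one point, so their measures add
  inside \<open>C\<close>.\<close>

lemma emeasure_compact_add_le_midpoints:
  fixes K L C :: "real set"
  assumes K: "compact K" "K \<noteq> {}" and L: "compact L" "L \<noteq> {}"
    and C [measurable]: "C \<in> sets borel"
    and mid: "\<And>x y. x \<in> K \<Longrightarrow> y \<in> L \<Longrightarrow> (x + y) / 2 \<in> C"
  shows "emeasure lborel K + emeasure lborel L \<le> 2 * emeasure lborel C"
proof -
  have [measurable]: "K \<in> sets borel" "L \<in> sets borel"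
    using K L by (auto intro: borel_compact)
  obtain a where a: "a \<in> K" "\<And>x. x \<in> K \<Longrightarrow> x \<le> a"
    using compact_attains_sup[OF K] by auto
  obtain b where b: "b \<in> L" "\<And>x. x \<in> L \<Longrightarrow> b \<le> x"
    using compact_attains_inf[OF L] by auto
  \<comment> \<open>\<open>P = (K + b) / 2\<close> and \<open>Q = (a + L) / 2\<close> overlap only in \<open>(a + b) / 2\<close>.\<close>
  define P where "P = {z. 2 * z - b \<in> K}"
  define Q where "Q = {z. 2 * z - a \<in> L}"
  have [measurable]: "P \<in> sets borel" "Q \<in> sets borel"
    unfolding P_def Q_def by measurable
  have sub: "P \<union> Q \<subseteq> C"
    using mid[OF _ b(1)] mid[OF a(1)] by (fastforce simp: P_def Q_def)
  have "P \<inter> Q \<subseteq> {(a + b) / 2}"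
    using a(2) b(2) by (force simp: P_def Q_def)
  then have "emeasure lborel (P \<inter> Q) = 0"
    by (metis emeasure_empty emeasure_lborel_singleton subset_singletonD)
  then have "emeasure lborel P + emeasure lborel Q = emeasure lborel (P \<union> Q)"
    using emeasure_Un_Int[of P lborel Q] by simp
  also have "\<dots> \<le> emeasure lborel C"
    by (intro emeasure_mono sub) simp
  finally have "2 * (emeasure lborel P + emeasure lborel Q) \<le> 2 * emeasure lborel C"
    by (rule mult_left_mono) simp
  then show ?thesis
    unfolding P_def Q_def distrib_left by (simp flip: emeasure_lborel_vimage_double)
qed

text \<open>The compact case is extended to Borel sets one set at a time: first \<open>A\<close> is
  exhausted by compact sets with \<open>L\<close> fixed, then \<open>B\<close> with \<open>A\<close>
  fixed.\<close>

lemma Brunn_Minkowski_real: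
  fixes A B C :: "real set"
  assumes [measurable]: "A \<in> sets borel" "B \<in> sets borel" "C \<in> sets borel"
    and ne: "A \<noteq> {}" "B \<noteq> {}"
    and mid: "\<And>x y. x \<in> A \<Longrightarrow> y \<in> B \<Longrightarrow> (x + y) / 2 \<in> C"
  shows "emeasure lborel A + emeasure lborel B \<le> 2 * emeasure lborel C"
proof -
  let ?c = "2 * emeasure lborel C"
  obtain a b where ab: "a \<in> A" "b \<in> B"
    using ne by auto
  have KL: "emeasure lborel K + emeasure lborel L \<le> ?c"
    if "compact K" "K \<subseteq> A" "compact L" "L \<subseteq> B" for K L
  proof -
    \<comment> \<open>\<open>K\<close> or \<open>L\<close> may be empty here, and those cases are
      used below; inserting \<open>a\<close> and \<open>b\<close> makes both sets nonempty.\<close>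
    have "emeasure lborel K + emeasure lborel L
        \<le> emeasure lborel (insert a K) + emeasure lborel (insert b L)"
      using that by (intro add_mono emeasure_mono) (auto intro: borel_compact)
    also have "\<dots> \<le> ?c"
      using that ab by (intro emeasure_compact_add_le_midpoints mid) auto
    finally show ?thesis .
  qed
  have AL: "emeasure lborel A + emeasure lborel L \<le> ?c" if "compact L" "L \<subseteq> B" for L
  proof -
    have "emeasure lborel A \<le> ?c - emeasure lborel L"
    proof (rule emeasure_le_if_compact_le)
      show "emeasure lborel K \<le> ?c - emeasure lborel L" if "compact K" "K \<subseteq> A" for K
        unfolding ennreal_le_minus_iff using KL that \<open>compact L\<close> \<open>L \<subseteq> B\<close> by blast
    qed simp
    \<comment> \<open>Subtraction on \<open>ennreal\<close> is truncated, so the previous bound says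
      nothing about \<open>L\<close> when \<open>A\<close> has measure 0; this covers that
      case.\<close>
    moreover have "emeasure lborel L \<le> ?c"
      using KL[of "{}" L] that by simp
    ultimately show ?thesis
      unfolding ennreal_le_minus_iff by auto
  qed
  have "emeasure lborel B \<le> ?c - emeasure lborel A"
  proof (rule emeasure_le_if_compact_le)
    show "emeasure lborel L \<le> ?c - emeasure lborel A" if "compact L" "L \<subseteq> B" for L
      unfolding ennreal_le_minus_iff using AL[OF that] by (simp add: add.commute)
  qed simp
  moreover have "emeasure lborel A \<le> ?c"
    using AL[of "{}"] by simp
  ultimately show ?thesis
    unfolding ennreal_le_minus_iff by (auto simp: add.commute)
qed

section \<open>Prekopa--Leindler on the line\<close>

text \<open>Each value \<open>f x\<close>, finite or not, is the length of the set of real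
  \<open>t \<ge> 0\<close> below it; exchanging the two integrals gives the measures of the
  superlevel sets.\<close>

lemma nn_integral_layer_cake:
  fixes f :: "'a \<Rightarrow> ennreal"
  assumes "sigma_finite_measure M" and f [measurable]: "f \<in> borel_measurable M"
  shows "(\<integral>\<^sup>+x. f x \<partial>M)
    = (\<integral>\<^sup>+t. indicator {0..} t * emeasure M {x \<in> space M. ennreal t < f x} \<partial>lborel)"
proof -
  interpret sigma_finite_measure M by fact
  interpret pair_sigma_finite M "lborel :: real measure" ..
  have eq: "{t. 0 \<le> t \<and> ennreal t < y} = (if y = top then {0..} else {0..<enn2real y})"
    for y by (cases y) (auto simp: ennreal_less_iff)
  have "emeasure lborel {0::real..} = top"
  proof -
    have "of_nat n \<le> emeasure lborel {0::real..}" for n :: nat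
      using emeasure_mono[of "{0..real n}" "{0..}" lborel] by (simp add: ennreal_of_nat_eq_real_of_nat)
    then show ?thesis
      by (metis ennreal_Ex_less_of_nat linorder_not_less top.not_eq_extremum infinity_ennreal_def)
  qed
  then have "f x = emeasure lborel {t. 0 \<le> t \<and> ennreal t < f x}" for x
    unfolding eq by (cases "f x") auto
  then have "(\<integral>\<^sup>+x. f x \<partial>M) = (\<integral>\<^sup>+x. emeasure lborel {t. 0 \<le> t \<and> ennreal t < f x} \<partial>M)"
    by (intro nn_integral_cong) auto
  also have "\<dots> = (\<integral>\<^sup>+x. \<integral>\<^sup>+t. indicator {t. 0 \<le> t \<and> ennreal t < f x} t \<partial>lborel \<partial>M)"
    by simp
  also have "\<dots> = (\<integral>\<^sup>+x. \<integral>\<^sup>+t. indicator {0..} t * indicator {z. ennreal t < f z} x \<partial>lborel \<partial>M)"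
    by (intro nn_integral_cong) (auto split: split_indicator)
  also have "\<dots> = (\<integral>\<^sup>+t. \<integral>\<^sup>+x. indicator {0..} t * indicator {z. ennreal t < f z} x \<partial>M \<partial>lborel)"
    by (rule Fubini'[symmetric]) measurable
  also have "\<dots> = (\<integral>\<^sup>+t. \<integral>\<^sup>+x. indicator {0..} t * indicator {z \<in> space M. ennreal t < f z} x \<partial>M \<partial>lborel)"
    by (intro nn_integral_cong) (auto split: split_indicator)
  also have "\<dots> = (\<integral>\<^sup>+t. indicator {0..} t * emeasure M {x \<in> space M. ennreal t < f x} \<partial>lborel)"
    by (intro nn_integral_cong nn_integral_cmult_indicator) measurable
  finally show ?thesis .
qed

lemma ennreal_amgm:
  fixes x y z :: ennreal
  assumes "x + y \<le> 2 * z"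
  shows "x * y \<le> z\<^sup>2"
proof (cases z)
  case (real r)
  have "2 * ennreal r = ennreal (2 * r)"
    using real by (simp add: ennreal_mult)
  with assms real have le: "x + y \<le> ennreal (2 * r)"
    by simp
  then have "x < top" "y < top"
    by (auto simp: less_top[symmetric] top_unique)
  then obtain s t where st: "x = ennreal s" "0 \<le> s" "y = ennreal t" "0 \<le> t"
    by (metis ennreal_cases less_irrefl)
  with le real have "s + t \<le> 2 * r"
    by (simp flip: ennreal_plus)
  then have "(s + t)\<^sup>2 \<le> (2 * r)\<^sup>2"
    using st by (intro power_mono) auto
  moreover have "0 \<le> (s - t)\<^sup>2"
    by simp
  ultimately have "s * t \<le> r\<^sup>2"
    by (simp add: power2_eq_square algebra_simps)
  with st real show ?thesis
    by (simp add: ennreal_power flip: ennreal_mult)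
qed (simp add: power2_eq_square)

text \<open>Prekopa--Leindler is stated with a square on the right, which avoids roots of extended
  reals; this lemma takes the root where one is wanted.\<close>

lemma ennreal_power2_le_imp_le:
  fixes x y :: ennreal
  assumes "x\<^sup>2 \<le> y\<^sup>2"
  shows "x \<le> y"
proof (rule ccontr)
  assume "\<not> x \<le> y"
  then have less: "y < x"
    by simp
  then have "y * x \<le> x * x"
    by (intro mult_right_mono) auto
  also have "\<dots> \<le> y * y"
    using assms by (simp add: power2_eq_square)
  finally have "y * x \<le> y * y" .
  moreover have "y \<noteq> 0" "y \<noteq> top"
    using assms less by auto
  ultimately show False
    using less by (simp add: ennreal_mult_le_mult_iff)
qed

text \<open>Midpoints of points from the superlevel sets of \<open>f\<close> and \<open>g\<close> at
  height \<open>t\<close> lie in that of \<open>h\<close>, so Brunn--Minkowski applies at each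
  height below 1, and integrating over \<open>t\<close> gives the claim. Normalisation yields a sum
  on the left, which is stronger than the product form.\<close>

lemma Prekopa_Leindler_real_normalized:
  fixes f g h :: "real \<Rightarrow> ennreal"
  assumes [measurable]: "f \<in> borel_measurable borel" "g \<in> borel_measurable borel"
      "h \<in> borel_measurable borel"
    and le: "\<And>x y. f x * g y \<le> (h ((x + y) / 2))\<^sup>2"
    and sup: "(SUP x. f x) = 1" "(SUP x. g x) = 1"
  shows "(\<integral>\<^sup>+x. f x \<partial>lborel) + (\<integral>\<^sup>+x. g x \<partial>lborel) \<le> 2 * (\<integral>\<^sup>+x. h x \<partial>lborel)"
proof -
  \<comment> \<open>Both suprema are 1, so the level sets on the left are both nonempty or both empty.\<close>
  have level: "emeasure lborel {x. ennreal t < f x} + emeasure lborel {x. ennreal t < g x}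
      \<le> 2 * emeasure lborel {x. ennreal t < h x}" if "0 \<le> t" for t
  proof (cases "t < 1")
    case True
    then have t: "ennreal t < 1"
      using that by (simp add: ennreal_less_one_iff)
    show ?thesis
    proof (rule Brunn_Minkowski_real)
      show "{x. ennreal t < f x} \<noteq> {}" "{x. ennreal t < g x} \<noteq> {}"
        using t less_SUP_iff[of "ennreal t" f UNIV] less_SUP_iff[of "ennreal t" g UNIV]
        by (auto simp: sup)
      fix x y assume "x \<in> {x. ennreal t < f x}" "y \<in> {x. ennreal t < g x}"
      \<comment> \<open>The square of the minimum is at most \<open>f x * g y\<close>, which brings
        in the hypothesis on \<open>h\<close>.\<close>
      then have "ennreal t < min (f x) (g y)"
        by simp
      also have "\<dots> \<le> h ((x + y) / 2)"
      proof (rule ennreal_power2_le_imp_le)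
        show "(min (f x) (g y))\<^sup>2 \<le> (h ((x + y) / 2))\<^sup>2"
          unfolding power2_eq_square[of "min _ _"] by (intro order_trans[OF mult_mono le]) auto
      qed
      finally show "(x + y) / 2 \<in> {x. ennreal t < h x}"
        by simp
    qed measurable
  next
    case False
    have "f x \<le> ennreal t" "g x \<le> ennreal t" for x
    proof -
      have "f x \<le> 1" "g x \<le> 1"
        using SUP_upper[of x UNIV f] SUP_upper[of x UNIV g] by (auto simp: sup)
      moreover have "1 \<le> ennreal t"
        using False by simp
      ultimately show "f x \<le> ennreal t" "g x \<le> ennreal t"
        by (blast intro: order_trans)+
    qed
    then have "{x. ennreal t < f x} = {}" "{x. ennreal t < g x} = {}"
      by (auto simp: not_less)
    then show ?thesis
      by simp
  qed
  have cake: "(\<integral>\<^sup>+x. u x \<partial>lborel)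
      = (\<integral>\<^sup>+t. indicator {0..} t * emeasure lborel {x. ennreal t < u x} \<partial>lborel)"
    if "u \<in> borel_measurable borel" for u :: "real \<Rightarrow> ennreal"
    using nn_integral_layer_cake[of lborel u] that by (simp add: sigma_finite_lborel)
  have [measurable]: "(\<lambda>t. emeasure lborel {x. ennreal t < u x}) \<in> borel_measurable borel"
    if [measurable]: "u \<in> borel_measurable borel" for u :: "real \<Rightarrow> ennreal"
    by measurable
  have "(\<integral>\<^sup>+x. f x \<partial>lborel) + (\<integral>\<^sup>+x. g x \<partial>lborel)
      = (\<integral>\<^sup>+t. indicator {0..} t * emeasure lborel {x. ennreal t < f x}
          + indicator {0..} t * emeasure lborel {x. ennreal t < g x} \<partial>lborel)"
    by (simp add: cake[of f] cake[of g] nn_integral_add)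
  also have "\<dots> \<le> (\<integral>\<^sup>+t. 2 * (indicator {0..} t * emeasure lborel {x. ennreal t < h x}) \<partial>lborel)"
    using level by (intro nn_integral_mono) (auto split: split_indicator)
  also have "\<dots> = 2 * (\<integral>\<^sup>+x. h x \<partial>lborel)"
    by (simp add: cake[of h] nn_integral_cmult)
  finally show ?thesis .
qed

text \<open>Dividing \<open>f\<close> and \<open>g\<close> by their suprema \<open>a\<close> and
  \<open>b\<close>, and \<open>h\<close> by \<open>sqrt (a * b)\<close>, preserves the hypothesis.
  The normalised bound and AM-GM give the product form, where the factor \<open>1 / (a * b)\<close>
  appears on both sides and cancels.\<close>

lemma Prekopa_Leindler_real_bounded:
  fixes f g h :: "real \<Rightarrow> ennreal"
  assumes [measurable]: "f \<in> borel_measurable borel" "g \<in> borel_measurable borel"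
      "h \<in> borel_measurable borel"
    and le: "\<And>x y. f x * g y \<le> (h ((x + y) / 2))\<^sup>2"
    and bdd: "(SUP x. f x) < top" "(SUP x. g x) < top"
  shows "(\<integral>\<^sup>+x. f x \<partial>lborel) * (\<integral>\<^sup>+x. g x \<partial>lborel) \<le> (\<integral>\<^sup>+x. h x \<partial>lborel)\<^sup>2"
proof (cases "(SUP x. f x) = 0 \<or> (SUP x. g x) = 0")
  case True
  then have "(\<forall>x. f x = 0) \<or> (\<forall>x. g x = 0)"
    by (metis SUP_upper UNIV_I le_zero_eq)
  then show ?thesis
    by auto
next
  case False
  obtain a b where a: "(SUP x. f x) = ennreal a" "0 \<le> a" and b: "(SUP x. g x) = ennreal b" "0 \<le> b"
    using bdd by (metis ennreal_cases less_irrefl)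
  with False have pos: "0 < a" "0 < b"
    by (auto simp: less_le)
  define c where "c = sqrt (a * b)"
  have c: "0 < c" "c\<^sup>2 = a * b"
    using pos by (auto simp: c_def)
  have c2: "(ennreal (1 / c) * z)\<^sup>2 = ennreal (1 / (a * b)) * z\<^sup>2" for z
    using c by (simp add: power_mult_distrib ennreal_power power_one_over power_divide)
  have ab: "ennreal (1 / a) * w * (ennreal (1 / b) * z) = ennreal (1 / (a * b)) * (w * z)" for w z
    using pos by (simp add: ennreal_mult[symmetric] mult_ac flip: mult.assoc)
  have "(\<integral>\<^sup>+x. ennreal (1 / a) * f x \<partial>lborel) + (\<integral>\<^sup>+x. ennreal (1 / b) * g x \<partial>lborel)
      \<le> 2 * (\<integral>\<^sup>+x. ennreal (1 / c) * h x \<partial>lborel)"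
  proof (rule Prekopa_Leindler_real_normalized)
    show "(SUP x. ennreal (1 / a) * f x) = 1" "(SUP x. ennreal (1 / b) * g x) = 1"
      using a b pos by (simp_all add: SUP_mult_left_ennreal[symmetric] ennreal_mult[symmetric])
    show "ennreal (1 / a) * f x * (ennreal (1 / b) * g y) \<le> (ennreal (1 / c) * h ((x + y) / 2))\<^sup>2" for x y
      unfolding c2 ab by (intro mult_left_mono le) simp
  qed measurable
  then have "ennreal (1 / a) * (\<integral>\<^sup>+x. f x \<partial>lborel) * (ennreal (1 / b) * (\<integral>\<^sup>+x. g x \<partial>lborel))
      \<le> (ennreal (1 / c) * (\<integral>\<^sup>+x. h x \<partial>lborel))\<^sup>2"
    by (intro ennreal_amgm) (simp add: nn_integral_cmult)
  then show ?thesis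
    unfolding c2 ab using pos by (subst (asm) ennreal_mult_le_mult_iff) auto
qed

lemma nn_integral_eq_SUP_truncation:
  fixes f :: "'a \<Rightarrow> ennreal"
  assumes [measurable]: "f \<in> borel_measurable M"
  shows "(\<integral>\<^sup>+x. f x \<partial>M) = (SUP n. \<integral>\<^sup>+x. min (f x) (of_nat n) \<partial>M)"
proof -
  have "(SUP n. min y (of_nat n)) = y" for y :: ennreal
  proof (rule antisym)
    show "y \<le> (SUP n. min y (of_nat n))"
    proof (rule dense_le)
      fix z assume "z < y"
      moreover obtain n where "z < of_nat n"
        using \<open>z < y\<close> ennreal_Ex_less_of_nat[of z] by (auto simp: less_top dest: less_le_trans[OF _ top_greatest])
      ultimately show "z \<le> (SUP n. min y (of_nat n))"
        by (intro SUP_upper2[of n]) auto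
    qed
  qed (auto intro: SUP_least)
  then have "(\<integral>\<^sup>+x. f x \<partial>M) = (\<integral>\<^sup>+x. (SUP n. min (f x) (of_nat n)) \<partial>M)"
    by simp
  also have "\<dots> = (SUP n. \<integral>\<^sup>+x. min (f x) (of_nat n) \<partial>M)"
  proof (rule nn_integral_monotone_convergence_SUP)
    show "incseq (\<lambda>n x. min (f x) (of_nat n))"
      unfolding incseq_def le_fun_def by (intro allI impI min.mono order_refl of_nat_mono)
  qed measurable
  finally show ?thesis .
qed

text \<open>Truncating \<open>f\<close> and \<open>g\<close> only lowers the left side of the
  hypothesis, so the bounded case holds with the same \<open>h\<close> for all levels
  \<open>m\<close> and \<open>n\<close>; the suprema over both levels recover the full
  integrals.\<close>

lemma Prekopa_Leindler_real:
  fixes f g h :: "real \<Rightarrow> ennreal"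
  assumes [measurable]: "f \<in> borel_measurable borel" "g \<in> borel_measurable borel"
      "h \<in> borel_measurable borel"
    and le: "\<And>x y. f x * g y \<le> (h ((x + y) / 2))\<^sup>2"
  shows "(\<integral>\<^sup>+x. f x \<partial>lborel) * (\<integral>\<^sup>+x. g x \<partial>lborel) \<le> (\<integral>\<^sup>+x. h x \<partial>lborel)\<^sup>2"
proof -
  have "(\<integral>\<^sup>+x. min (f x) (of_nat m) \<partial>lborel) * (\<integral>\<^sup>+x. min (g x) (of_nat n) \<partial>lborel)
      \<le> (\<integral>\<^sup>+x. h x \<partial>lborel)\<^sup>2" for m n
  proof (rule Prekopa_Leindler_real_bounded)
    show "min (f x) (of_nat m) * min (g y) (of_nat n) \<le> (h ((x + y) / 2))\<^sup>2" for x y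
      by (intro order_trans[OF mult_mono le]) auto
    show "(SUP x. min (f x) (of_nat m)) < top" "(SUP x. min (g x) (of_nat n)) < top"
      using SUP_least[of UNIV "\<lambda>x. min (f x) (of_nat m)" "of_nat m"]
        SUP_least[of UNIV "\<lambda>x. min (g x) (of_nat n)" "of_nat n"]
      by (auto intro: le_less_trans simp: of_nat_less_top)
  qed measurable
  then show ?thesis
    by (simp add: nn_integral_eq_SUP_truncation[of f] nn_integral_eq_SUP_truncation[of g]
        SUP_mult_left_ennreal SUP_mult_right_ennreal SUP_le_iff)
qed

section \<open>Prekopa--Leindler in several dimensions\<close>

text \<open>Induction on the coordinates: the slices of \<open>f\<close>, \<open>g\<close>,
  \<open>h\<close> at heights \<open>s\<close>, \<open>t\<close>, \<open>(s + t) / 2\<close> satisfy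
  the hypothesis over \<open>I\<close>. By induction their integrals, as functions of the height,
  satisfy the one-dimensional hypothesis.\<close>

lemma Prekopa_Leindler_PiM:
  fixes f g h :: "('i \<Rightarrow> real) \<Rightarrow> ennreal"
  assumes "finite I"
    and "f \<in> borel_measurable (Pi\<^sub>M I (\<lambda>_. lborel))" "g \<in> borel_measurable (Pi\<^sub>M I (\<lambda>_. lborel))"
      "h \<in> borel_measurable (Pi\<^sub>M I (\<lambda>_. lborel))"
    and "\<And>x y. x \<in> extensional I \<Longrightarrow> y \<in> extensional I
      \<Longrightarrow> f x * g y \<le> (h (\<lambda>i\<in>I. (x i + y i) / 2))\<^sup>2"
  shows "(\<integral>\<^sup>+x. f x \<partial>Pi\<^sub>M I (\<lambda>_. lborel)) * (\<integral>\<^sup>+x. g x \<partial>Pi\<^sub>M I (\<lambda>_. lborel))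
    \<le> (\<integral>\<^sup>+x. h x \<partial>Pi\<^sub>M I (\<lambda>_. lborel))\<^sup>2"
  using assms
proof (induction I arbitrary: f g h rule: finite_induct)
  case empty
  interpret product_sigma_finite "\<lambda>_::'i. lborel :: real measure" ..
  \<comment> \<open>The product space over no coordinates is the single point
    \<open>\<lambda>_. undefined\<close>, with mass 1.\<close>
  show ?case
    using empty.prems(4)[of "\<lambda>_. undefined" "\<lambda>_. undefined"] by (simp add: nn_integral_empty restrict_def)
next
  case (insert i I)
  interpret product_sigma_finite "\<lambda>_::'i. lborel :: real measure" ..
  interpret I: finite_product_sigma_finite "\<lambda>_::'i. lborel :: real measure" I
    by standard fact
  note [measurable] = insert.prems(1-3)
  have slice [measurable]: "(\<lambda>x. u (x(i := s))) \<in> borel_measurable (Pi\<^sub>M I (\<lambda>_. lborel))"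
    if [measurable]: "u \<in> borel_measurable (Pi\<^sub>M (insert i I) (\<lambda>_. lborel))"
    for u :: "('i \<Rightarrow> real) \<Rightarrow> ennreal" and s
    by measurable
  have marginal: "(\<lambda>s. \<integral>\<^sup>+x. u (x(i := s)) \<partial>Pi\<^sub>M I (\<lambda>_. lborel)) \<in> borel_measurable borel"
    if [measurable]: "u \<in> borel_measurable (Pi\<^sub>M (insert i I) (\<lambda>_. lborel))"
    for u :: "('i \<Rightarrow> real) \<Rightarrow> ennreal"
  proof -
    have "(\<lambda>s. \<integral>\<^sup>+x. u (x(i := s)) \<partial>Pi\<^sub>M I (\<lambda>_. lborel)) \<in> borel_measurable lborel"
      by measurable
    then show ?thesis by simp
  qed
  have "(\<integral>\<^sup>+x. f (x(i := s)) \<partial>Pi\<^sub>M I (\<lambda>_. lborel)) * (\<integral>\<^sup>+x. g (x(i := t)) \<partial>Pi\<^sub>M I (\<lambda>_. lborel))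
      \<le> (\<integral>\<^sup>+x. h (x(i := (s + t) / 2)) \<partial>Pi\<^sub>M I (\<lambda>_. lborel))\<^sup>2" for s t
  proof (rule insert.IH)
    fix x y :: "'i \<Rightarrow> real" assume "x \<in> extensional I" "y \<in> extensional I"
    then have "f (x(i := s)) * g (y(i := t))
        \<le> (h (\<lambda>j\<in>insert i I. ((x(i := s)) j + (y(i := t)) j) / 2))\<^sup>2"
      by (intro insert.prems(4)) (auto simp: extensional_def)
    also have "(\<lambda>j\<in>insert i I. ((x(i := s)) j + (y(i := t)) j) / 2)
        = (\<lambda>j\<in>I. (x j + y j) / 2)(i := (s + t) / 2)"
      by (auto simp: fun_eq_iff)
    finally show "f (x(i := s)) * g (y(i := t)) \<le> (h ((\<lambda>j\<in>I. (x j + y j) / 2)(i := (s + t) / 2)))\<^sup>2" .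
  qed (intro slice insert.prems)+
  then have "(\<integral>\<^sup>+s. \<integral>\<^sup>+x. f (x(i := s)) \<partial>Pi\<^sub>M I (\<lambda>_. lborel) \<partial>lborel)
        * (\<integral>\<^sup>+s. \<integral>\<^sup>+x. g (x(i := s)) \<partial>Pi\<^sub>M I (\<lambda>_. lborel) \<partial>lborel)
      \<le> (\<integral>\<^sup>+s. \<integral>\<^sup>+x. h (x(i := s)) \<partial>Pi\<^sub>M I (\<lambda>_. lborel) \<partial>lborel)\<^sup>2"
    by (intro Prekopa_Leindler_real marginal insert.prems)
  then show ?case
    using insert.hyps insert.prems(1-3) by (simp add: product_nn_integral_insert_rev)
qed

text \<open>Lebesgue measure is the image of the product measure under the coordinate map
  \<open>?s\<close>, and this map is compatible with midpoints.\<close>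

theorem Prekopa_Leindler:
  fixes f g h :: "'a::euclidean_space \<Rightarrow> ennreal"
  assumes [measurable]: "f \<in> borel_measurable borel" "g \<in> borel_measurable borel"
      "h \<in> borel_measurable borel"
    and le: "\<And>x y. f x * g y \<le> (h ((x + y) /\<^sub>R 2))\<^sup>2"
  shows "(\<integral>\<^sup>+x. f x \<partial>lborel) * (\<integral>\<^sup>+x. g x \<partial>lborel) \<le> (\<integral>\<^sup>+x. h x \<partial>lborel)\<^sup>2"
proof -
  let ?P = "Pi\<^sub>M Basis (\<lambda>_. lborel) :: ('a \<Rightarrow> real) measure"
  let ?s = "\<lambda>x::'a \<Rightarrow> real. \<Sum>b\<in>Basis. x b *\<^sub>R b"
  have [measurable]: "?s \<in> measurable ?P borel"
    by measurable
  have eq: "(\<integral>\<^sup>+x. u x \<partial>lborel) = (\<integral>\<^sup>+x. u (?s x) \<partial>?P)"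
    if "u \<in> borel_measurable borel" for u :: "'a \<Rightarrow> ennreal"
    using that by (subst lborel_eq) (simp add: nn_integral_distr)
  have "(\<integral>\<^sup>+x. f (?s x) \<partial>?P) * (\<integral>\<^sup>+x. g (?s x) \<partial>?P) \<le> (\<integral>\<^sup>+x. h (?s x) \<partial>?P)\<^sup>2"
  proof (rule Prekopa_Leindler_PiM)
    have mid: "?s (\<lambda>b\<in>Basis. (x b + y b) / 2) = (?s x + ?s y) /\<^sub>R 2" for x y
    proof -
      have "((x b + y b) / 2) *\<^sub>R b = (x b *\<^sub>R b + y b *\<^sub>R b) /\<^sub>R 2" for b :: 'a
        by (simp only: divide_inverse mult.commute[of _ "inverse 2"] scaleR_add_left flip: scaleR_scaleR)
      then have "?s (\<lambda>b\<in>Basis. (x b + y b) / 2) = (\<Sum>b\<in>Basis. (x b *\<^sub>R b + y b *\<^sub>R b) /\<^sub>R 2)"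
        by (intro sum.cong refl) (simp only: restrict_apply if_True)
      also have "\<dots> = (?s x + ?s y) /\<^sub>R 2"
        by (simp only: sum.distrib scaleR_sum_right[symmetric])
      finally show ?thesis .
    qed
    show "f (?s x) * g (?s y) \<le> (h (?s (\<lambda>b\<in>Basis. (x b + y b) / 2)))\<^sup>2" for x y
      unfolding mid by (rule le)
  qed measurable
  then show ?thesis
    unfolding eq[OF assms(1)] eq[OF assms(2)] eq[OF assms(3)] .
qed

section \<open>Linear substitutions\<close>

lemma nn_integral_lborel_affine:
  fixes f :: "'a::euclidean_space \<Rightarrow> ennreal"
  assumes [measurable]: "f \<in> borel_measurable borel" and "c \<noteq> 0"
  shows "(\<integral>\<^sup>+x. f x \<partial>lborel) = ennreal (\<bar>c\<bar> ^ DIM('a)) * (\<integral>\<^sup>+x. f (t + c *\<^sub>R x) \<partial>lborel)"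
proof -
  have "(\<integral>\<^sup>+x. f x \<partial>lborel)
      = (\<integral>\<^sup>+x. f x \<partial>density (distr lborel borel (\<lambda>x. t + c *\<^sub>R x)) (\<lambda>_. ennreal (\<bar>c\<bar> ^ DIM('a))))"
    using lborel_affine[OF \<open>c \<noteq> 0\<close>, of t] by simp
  also have "\<dots> = ennreal (\<bar>c\<bar> ^ DIM('a)) * (\<integral>\<^sup>+x. f (t + c *\<^sub>R x) \<partial>lborel)"
    by (subst nn_integral_density, simp, simp, subst nn_integral_cmult, simp, subst nn_integral_distr) simp_all
  finally show ?thesis .
qed

text \<open>The substitution is split in two: \<open>x = y + 2 *\<^sub>R v\<close> for fixed
  \<open>y\<close>, which gives the factor \<open>2 ^ DIM('a)\<close>, and, after Fubini, the
  translation \<open>y = u - v\<close> for fixed \<open>v\<close>.\<close>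

lemma nn_integral_lborel_sum_diff:
  fixes f g :: "'a::euclidean_space \<Rightarrow> ennreal"
  assumes [measurable]: "f \<in> borel_measurable borel" "g \<in> borel_measurable borel"
  shows "(\<integral>\<^sup>+x. f x \<partial>lborel) * (\<integral>\<^sup>+y. g y \<partial>lborel)
    = 2 ^ DIM('a) * (\<integral>\<^sup>+v. \<integral>\<^sup>+u. f (u + v) * g (u - v) \<partial>lborel \<partial>lborel)"
proof -
  have "(\<integral>\<^sup>+x. f x \<partial>lborel) * (\<integral>\<^sup>+y. g y \<partial>lborel)
      = (\<integral>\<^sup>+y. (\<integral>\<^sup>+x. f x \<partial>lborel) * g y \<partial>lborel)"
    by (simp add: nn_integral_cmult)
  also have "\<dots> = (\<integral>\<^sup>+y. (2 ^ DIM('a) * (\<integral>\<^sup>+v. f (y + 2 *\<^sub>R v) \<partial>lborel)) * g y \<partial>lborel)"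
    using nn_integral_lborel_affine[of f 2] by (simp add: ennreal_power[symmetric])
  also have "\<dots> = 2 ^ DIM('a) * (\<integral>\<^sup>+y. \<integral>\<^sup>+v. f (y + 2 *\<^sub>R v) * g y \<partial>lborel \<partial>lborel)"
    by (simp add: nn_integral_cmult nn_integral_multc mult.assoc)
  also have "(\<integral>\<^sup>+y. \<integral>\<^sup>+v. f (y + 2 *\<^sub>R v) * g y \<partial>lborel \<partial>lborel)
      = (\<integral>\<^sup>+v. \<integral>\<^sup>+y. f (y + 2 *\<^sub>R v) * g y \<partial>lborel \<partial>lborel)"
    by (rule lborel_pair.Fubini') measurable
  also have "\<dots> = (\<integral>\<^sup>+v. \<integral>\<^sup>+u. f (u + v) * g (u - v) \<partial>lborel \<partial>lborel)"
  proof (rule nn_integral_cong)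
    fix v :: 'a
    have "(\<integral>\<^sup>+y. f (y + 2 *\<^sub>R v) * g y \<partial>lborel) = (\<integral>\<^sup>+u. f (u - v + 2 *\<^sub>R v) * g (u - v) \<partial>lborel)"
      by (subst nn_integral_lborel_affine[of _ 1 "- v"]) simp_all
    also have "(\<lambda>u. f (u - v + 2 *\<^sub>R v) * g (u - v)) = (\<lambda>u. f (u + v) * g (u - v))"
      by (simp add: scaleR_2)
    finally show "(\<integral>\<^sup>+y. f (y + 2 *\<^sub>R v) * g y \<partial>lborel) = (\<integral>\<^sup>+u. f (u + v) * g (u - v) \<partial>lborel)" .
  qed
  finally show ?thesis .
qed

lemma nn_integral_lborel_minus:
  fixes f :: "'a::euclidean_space \<Rightarrow> ennreal"
  assumes "f \<in> borel_measurable borel"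
  shows "(\<integral>\<^sup>+x. f (- x) \<partial>lborel) = (\<integral>\<^sup>+x. f x \<partial>lborel)"
  using nn_integral_lborel_affine[OF assms, of "- 1" 0] by simp

section \<open>Gaussian measure of symmetric convex sets\<close>

lemma convex_symmetric_half_diff:
  assumes "convex A" "symmetric_about_origin A" "a \<in> A" "b \<in> A"
  shows "(a - b) /\<^sub>R 2 \<in> A"
proof -
  have "- b \<in> A"
    using assms(2,4) by (auto simp: symmetric_about_origin_def)
  then have "inverse 2 *\<^sub>R a + inverse 2 *\<^sub>R (- b) \<in> A"
    using assms by (intro convexD) auto
  then show ?thesis
    by (simp add: scaleR_diff_right)
qed

text \<open>Prekopa--Leindler is applied to \<open>?f\<close>, its reflection and \<open>?h\<close>.
  Reflection keeps the integral, so the left side is a square and the root can be taken.\<close>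

lemma nn_integral_gaussian_translates_le:
  fixes A B :: "'a::euclidean_space set" and v :: 'a
  assumes [measurable]: "A \<in> sets borel" "B \<in> sets borel"
    and A: "convex A" "symmetric_about_origin A"
    and B: "convex B" "symmetric_about_origin B"
  shows "(\<integral>\<^sup>+u. ennreal (exp (- (norm u)\<^sup>2)) * (indicator A (u + v) * indicator B (u - v)) \<partial>lborel)
    \<le> (\<integral>\<^sup>+u. ennreal (exp (- (norm u)\<^sup>2)) * indicator (A \<inter> B) u \<partial>lborel)"
    (is "(\<integral>\<^sup>+u. ?f u \<partial>lborel) \<le> (\<integral>\<^sup>+u. ?h u \<partial>lborel)")
proof (rule ennreal_power2_le_imp_le)
  have "?f x * ?f (- y) \<le> (?h ((x + y) /\<^sub>R 2))\<^sup>2" for x y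
  proof (cases "x + v \<in> A \<and> x - v \<in> B \<and> - y + v \<in> A \<and> - y - v \<in> B")
    case True
    \<comment> \<open>The shifts cancel in the differences: \<open>(x + v) - (- y + v)\<close> and
      \<open>(x - v) - (- y - v)\<close> both equal \<open>x + y\<close>.\<close>
    have "(x + y) /\<^sub>R 2 \<in> A" "(x + y) /\<^sub>R 2 \<in> B"
      using convex_symmetric_half_diff[OF A, of "x + v" "- y + v"]
        convex_symmetric_half_diff[OF B, of "x - v" "- y - v"] True by (simp_all add: algebra_simps)
    \<comment> \<open>Log-concavity of the weight at midpoints, from the parallelogram law with the
      term in \<open>x - y\<close> dropped.\<close>
    moreover have "- (norm x)\<^sup>2 + - (norm y)\<^sup>2 \<le> 2 * - (norm ((x + y) /\<^sub>R 2))\<^sup>2"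
    proof -
      have "(norm (x + y))\<^sup>2 + (norm (x - y))\<^sup>2 = 2 * (norm x)\<^sup>2 + 2 * (norm y)\<^sup>2"
        by (simp add: power2_norm_eq_inner inner_simps inner_commute)
      moreover have "(norm ((x + y) /\<^sub>R 2))\<^sup>2 = (norm (x + y))\<^sup>2 / 4"
        unfolding norm_scaleR power_mult_distrib by (simp add: power2_eq_square)
      ultimately show ?thesis
        using zero_le_power2[of "norm (x - y)"] by linarith
    qed
    then have "exp (- (norm x)\<^sup>2) * exp (- (norm y)\<^sup>2) \<le> (exp (- (norm ((x + y) /\<^sub>R 2))\<^sup>2))\<^sup>2"
      by (simp only: exp_double[symmetric] exp_add[symmetric] exp_le_cancel_iff)
    ultimately show ?thesis
      using True by (simp add: ennreal_power flip: ennreal_mult)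
  qed auto
  then have "(\<integral>\<^sup>+x. ?f x \<partial>lborel) * (\<integral>\<^sup>+x. ?f (- x) \<partial>lborel) \<le> (\<integral>\<^sup>+x. ?h x \<partial>lborel)\<^sup>2"
    by (intro Prekopa_Leindler) measurable
  also have "(\<integral>\<^sup>+x. ?f (- x) \<partial>lborel) = (\<integral>\<^sup>+x. ?f x \<partial>lborel)"
    by (rule nn_integral_lborel_minus) measurable
  finally show "(\<integral>\<^sup>+u. ?f u \<partial>lborel)\<^sup>2 \<le> (\<integral>\<^sup>+u. ?h u \<partial>lborel)\<^sup>2"
    unfolding power2_eq_square[of "\<integral>\<^sup>+u. ?f u \<partial>lborel"] .
qed

lemma emeasure_gaussian_measure:
  fixes A :: "'a::euclidean_space set"
  assumes [measurable]: "A \<in> sets borel"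
  shows "emeasure gaussian_measure A = ennreal ((2 * pi) powr (- (real DIM('a) / 2)))
    * (\<integral>\<^sup>+x. ennreal (exp (- (norm x)\<^sup>2 / 2)) * indicator A x \<partial>lborel)"
proof -
  have "emeasure gaussian_measure A = (\<integral>\<^sup>+x. ennreal ((2 * pi) powr (- (real DIM('a) / 2)))
      * (ennreal (exp (- (norm x)\<^sup>2 / 2)) * indicator A x) \<partial>lborel)"
    unfolding gaussian_measure_def mult.assoc[symmetric]
    by (subst emeasure_density) (simp_all add: ennreal_mult)
  also have "\<dots> = ennreal ((2 * pi) powr (- (real DIM('a) / 2)))
      * (\<integral>\<^sup>+x. ennreal (exp (- (norm x)\<^sup>2 / 2)) * indicator A x \<partial>lborel)"
    by (rule nn_integral_cmult) measurable
  finally show ?thesis .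
qed

text \<open>The total Gaussian mass 1 after rescaling by \<open>sqrt 2\<close>. It evaluates the
  integral over \<open>v\<close> left by the substitution; the product form avoids division on
  \<open>ennreal\<close>.\<close>

lemma nn_integral_exp_minus_norm_square:
  "ennreal (sqrt 2 ^ DIM('a)) * (ennreal ((2 * pi) powr (- (real DIM('a) / 2)))
    * (\<integral>\<^sup>+x. ennreal (exp (- (norm (x::'a::euclidean_space))\<^sup>2)) \<partial>lborel)) = 1"
proof -
  have "1 = emeasure (gaussian_measure :: 'a measure) UNIV"
    using prob_space.emeasure_space_1[OF prob_space_gaussian_measure] by simp
  also have "\<dots> = ennreal ((2 * pi) powr (- (real DIM('a) / 2)))
      * (\<integral>\<^sup>+x. ennreal (exp (- (norm (x::'a))\<^sup>2 / 2)) \<partial>lborel)"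
    by (simp add: emeasure_gaussian_measure)
  also have "(\<integral>\<^sup>+x. ennreal (exp (- (norm (x::'a))\<^sup>2 / 2)) \<partial>lborel)
      = ennreal (\<bar>sqrt 2\<bar> ^ DIM('a)) * (\<integral>\<^sup>+x. ennreal (exp (- (norm (0 + sqrt 2 *\<^sub>R (x::'a)))\<^sup>2 / 2)) \<partial>lborel)"
    by (rule nn_integral_lborel_affine) auto
  finally show ?thesis
    by (simp add: power_mult_distrib mult_ac)
qed

theorem gaussian_measure_Int_ge:
  fixes A B :: "'a::euclidean_space set"
  assumes [measurable]: "A \<in> sets borel" "B \<in> sets borel"
    and A: "convex A" "symmetric_about_origin A"
    and B: "convex B" "symmetric_about_origin B"
  shows "measure gaussian_measure A * measure gaussian_measure B
    \<le> 2 powr (real DIM('a) / 2) * measure gaussian_measure (A \<inter> B)"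
proof -
  interpret prob_space "gaussian_measure :: 'a measure"
    by (rule prob_space_gaussian_measure)
  let ?c = "ennreal ((2 * pi) powr (- (real DIM('a) / 2)))"
  let ?w = "\<lambda>x::'a. ennreal (exp (- (norm x)\<^sup>2))"
  let ?F = "\<lambda>S x. ennreal (exp (- (norm x)\<^sup>2 / 2)) * indicator S x :: ennreal"
  let ?W = "\<integral>\<^sup>+v. ?w v \<partial>lborel"
  have split_FF: "?F A (u + v) * ?F B (u - v) = ?w v * (?w u * (indicator A (u + v) * indicator B (u - v)))" for u v
  proof -
    \<comment> \<open>By the parallelogram law the two halved exponents add up to full ones,
      separating \<open>u\<close> from \<open>v\<close>.\<close>
    have "exp (- (norm (u + v))\<^sup>2 / 2) * exp (- (norm (u - v))\<^sup>2 / 2)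
        = exp (- (norm v)\<^sup>2) * exp (- (norm u)\<^sup>2)"
      unfolding exp_add[symmetric] by (simp add: power2_norm_eq_inner inner_simps inner_commute field_simps)
    then show ?thesis
      by (auto split: split_indicator simp flip: ennreal_mult)
  qed
  have "(\<integral>\<^sup>+x. ?F A x \<partial>lborel) * (\<integral>\<^sup>+x. ?F B x \<partial>lborel)
      = 2 ^ DIM('a) * (\<integral>\<^sup>+v. \<integral>\<^sup>+u. ?F A (u + v) * ?F B (u - v) \<partial>lborel \<partial>lborel)"
    by (rule nn_integral_lborel_sum_diff) measurable
  also have "\<dots> = 2 ^ DIM('a) * (\<integral>\<^sup>+v. ?w v *
      (\<integral>\<^sup>+u. ?w u * (indicator A (u + v) * indicator B (u - v)) \<partial>lborel) \<partial>lborel)"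
    unfolding split_FF by (subst nn_integral_cmult) simp_all
  also have "\<dots> \<le> 2 ^ DIM('a) * (\<integral>\<^sup>+v. ?w v * (\<integral>\<^sup>+u. ?w u * indicator (A \<inter> B) u \<partial>lborel) \<partial>lborel)"
    by (intro mult_left_mono nn_integral_mono nn_integral_gaussian_translates_le A B) auto
  also have "\<dots> = 2 ^ DIM('a) * (?W * (\<integral>\<^sup>+u. ?w u * indicator (A \<inter> B) u \<partial>lborel))"
    by (simp add: nn_integral_multc)
  also have "\<dots> \<le> 2 ^ DIM('a) * (?W * (\<integral>\<^sup>+u. ?F (A \<inter> B) u \<partial>lborel))"
    by (intro mult_left_mono nn_integral_mono mult_right_mono ennreal_leI) auto
  \<comment> \<open>One factor \<open>?c\<close> will normalise \<open>?W\<close>, the other the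
    integral over \<open>A \<inter> B\<close>.\<close>
  finally have "?c * ?c * ((\<integral>\<^sup>+x. ?F A x \<partial>lborel) * (\<integral>\<^sup>+x. ?F B x \<partial>lborel))
      \<le> ?c * ?c * (2 ^ DIM('a) * (?W * (\<integral>\<^sup>+u. ?F (A \<inter> B) u \<partial>lborel)))"
    by (rule mult_left_mono) simp
  then have le: "emeasure gaussian_measure A * emeasure gaussian_measure B
      \<le> 2 ^ DIM('a) * (?c * ?W) * emeasure gaussian_measure (A \<inter> B)"
    by (simp only: emeasure_gaussian_measure assms sets.Int mult_ac)
  \<comment> \<open>The Jacobian \<open>2 ^ DIM('a)\<close> is two copies of
    \<open>sqrt 2 ^ DIM('a)\<close>: one is absorbed by \<open>?c * ?W\<close>, the other is the
    constant of the theorem.\<close>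
  have "ennreal (sqrt 2) * ennreal (sqrt 2) = 2"
    by (simp flip: ennreal_mult)
  then have "2 ^ DIM('a) * (?c * ?W) = ennreal (sqrt 2 ^ DIM('a)) * (ennreal (sqrt 2 ^ DIM('a)) * (?c * ?W))"
    by (simp add: power_mult_distrib[symmetric] mult.assoc[symmetric] flip: ennreal_power)
  also have "\<dots> = ennreal (sqrt 2 ^ DIM('a))"
    unfolding nn_integral_exp_minus_norm_square by simp
  also have "sqrt 2 ^ DIM('a) = (2 powr (1 / 2)) powr real DIM('a)"
    by (simp add: powr_realpow powr_half_sqrt)
  also have "\<dots> = 2 powr (real DIM('a) / 2)"
    by (simp add: powr_powr)
  finally have "2 ^ DIM('a) * (?c * ?W) = ennreal (2 powr (real DIM('a) / 2))" .
  with le have "ennreal (measure gaussian_measure A * measure gaussian_measure B)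
      \<le> ennreal (2 powr (real DIM('a) / 2) * measure gaussian_measure (A \<inter> B))"
    by (simp add: emeasure_eq_measure ennreal_mult)
  then show ?thesis
    by (subst (asm) ennreal_le_iff) auto
qed

theorem mainTheorem6:
  fixes A B :: "(real ^ 'n) set"
  assumes "closed A" and "convex A" and "symmetric_about_origin A"
    and "closed B" and "convex B" and "symmetric_about_origin B"
  shows "measure gaussian_measure A * measure gaussian_measure B
      \<le> 2 powr (real CARD('n) / 2) * measure gaussian_measure (A \<inter> B)"
  using gaussian_measure_Int_ge[of A B] assms by (simp add: borel_closed)

end
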